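(* Let $n,k$ be positive integers and let $(Q,\cdot)$, $Q=\{1,\ldots,n\}$, be an idempotent $k$-translatable groupoid with $k$-translatable sequence $a_1,a_2,\ldots,a_n$. Put $c=2\cdot 1$ (the product in $Q$). Then for all $x,y\in Q$ and $i\in\{1,\ldots,n\}$: (i) $[kc-c-2k+1]_n=0$; (ii) $[(1-k)x]_n=[(1-k)y]_n$ implies $x=y$; (iii) $a_{[i+1]_n}=[a_i+(2-c)]_n=[1+i(2-c)]_n$; (iv) $x\cdot y=[(c-1)x+(2-c)y]_n$; (v) $(Q,\cdot)$ is a quasigroup if and only if $(k,n)=1$; (vi) if $(Q,\cdot)$ is a quasigroup, then $n$ is odd.
   Context: For an integer $m$, $[m]_n$ is the element of $\{1,\ldots,n\}$ congruent to $m$ modulo $n$, with the convention $0=n$; an equation $[u]_n=v$ with $v$ an integer means $u\equiv v\pmod n$. Elements of $Q$ are regarded as integers in arithmetic expressions and as residues modulo $n$ (so $2$ means $[2]_n$ as an element of $Q$). $(k,n)$ is the greatest common divisor. A groupoid on $Q=\{1,\ldots,n\}$ (naturally ordered) is a binary operation on $Q$; it is idempotent if $x\cdot x=x$ for all $x$. It is $k$-translatable if $i\cdot j=[i+1]_n\cdot[j+k]_n$ for all $i,j\in Q$; equivalently $i\cdot j=a_{[k-ki+j]_n}$, where $a_j=1\cdot j$ is the first row of the multiplication table; $a_1,\ldots,a_n$ is then called the $k$-translatable sequence. A quasigroup is a groupoid in which $ax=b$ and $xa=b$ are uniquely solvable for $x$. *)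

theory Defs
  imports "HOL-Number_Theory.Cong" "HOL-Library.FuncSet"
begin

text \<open>Elements of \<open>Q\<close> are represented directly as integers, so that they can be
  used in arithmetic expressions without coercions.\<close>

definition Q :: "int \<Rightarrow> int set" where
  "Q n = {1..n}"

text \<open>The representative of \<open>m\<close> modulo \<open>n\<close> in \<open>{1, \<dots>, n}\<close>: the shift
  by one makes multiples of \<open>n\<close> go to \<open>n\<close> rather than to 0.\<close>

definition res :: "int \<Rightarrow> int \<Rightarrow> int" where
  "res n m = (m - 1) mod n + 1"

lemma res_characterization:
  assumes "n > 0"
  shows "r = res n m \<longleftrightarrow> r \<in> Q n \<and> [r = m] (mod n)"
proof
  assume "r = res n m"
  then show "r \<in> Q n \<and> [r = m] (mod n)"
    using assms by (auto simp: res_def Q_def cong_def mod_simps add1_zle_eq)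
next
  assume *: "r \<in> Q n \<and> [r = m] (mod n)"
  then have "[r - 1 = m - 1] (mod n)"
    by (simp add: cong_diff)
  moreover have "(r - 1) mod n = r - 1"
    using * by (simp add: Q_def)
  ultimately show "r = res n m"
    by (simp add: res_def cong_def)
qed

definition groupoid :: "int \<Rightarrow> (int \<Rightarrow> int \<Rightarrow> int) \<Rightarrow> bool" where
  "groupoid n f \<longleftrightarrow> f \<in> Q n \<rightarrow> Q n \<rightarrow> Q n"

definition idempotent :: "int \<Rightarrow> (int \<Rightarrow> int \<Rightarrow> int) \<Rightarrow> bool" where
  "idempotent n f \<longleftrightarrow> (\<forall>x\<in>Q n. f x x = x)"

definition translatable :: "int \<Rightarrow> int \<Rightarrow> (int \<Rightarrow> int \<Rightarrow> int) \<Rightarrow> bool" where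
  "translatable n k f \<longleftrightarrow>
     (\<forall>i\<in>Q n. \<forall>j\<in>Q n. f i j = f (res n (i + 1)) (res n (j + k)))"

text \<open>For a \<open>k\<close>-translatable groupoid, the \<open>k\<close>-translatable sequence is the
  first row of the multiplication table.\<close>

definition translatable_sequence ::
    "int \<Rightarrow> int \<Rightarrow> (int \<Rightarrow> int \<Rightarrow> int) \<Rightarrow> (int \<Rightarrow> int) \<Rightarrow> bool" where
  "translatable_sequence n k f a \<longleftrightarrow> translatable n k f \<and> (\<forall>j\<in>Q n. a j = f 1 j)"

definition quasigroup :: "int \<Rightarrow> (int \<Rightarrow> int \<Rightarrow> int) \<Rightarrow> bool" where
  "quasigroup n f \<longleftrightarrow> groupoid n f \<and>
     (\<forall>a\<in>Q n. \<forall>b\<in>Q n. (\<exists>!x. x \<in> Q n \<and> f a x = b) \<and> (\<exists>!x. x \<in> Q n \<and> f x a = b))"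

end

theory Submission
  imports Defs
begin

text \<open>Translatability gives \<open>i \<cdot> j = a (j + k - k i)\<close> with indices modulo \<open>n\<close>, so idempotency
  reads \<open>a (k + (1 - k) x) = x\<close>. Hence \<open>1 - k\<close> is a unit modulo \<open>n\<close>; with inverse \<open>u\<close> this
  means \<open>a m = u (m - k)\<close> and \<open>i \<cdot> j = u j - u k i\<close>. Evaluating at \<open>(2, 1)\<close> gives \<open>u = 2 - c\<close>, and
  then \<open>- u k = 1 - u = c - 1\<close>. The operation is a quasigroup iff both coefficients are units,
  that is, iff \<open>k\<close> is one. In that case \<open>k\<close> and \<open>1 - k\<close>, one of which is even, are both coprime
  to \<open>n\<close>.\<close>

lemma res_in_Q: "n > 0 \<Longrightarrow> res n m \<in> Q n"
  and cong_res: "n > 0 \<Longrightarrow> [res n m = m] (mod n)"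
  using res_characterization[of n "res n m" m] by auto

lemma res_eq_self: "n > 0 \<Longrightarrow> x \<in> Q n \<Longrightarrow> res n x = x"
  using res_characterization[of n x x] by auto

lemma res_eq_iff: "n > 0 \<Longrightarrow> res n x = res n y \<longleftrightarrow> [x = y] (mod n)"
  by (metis cong_res cong_sym cong_trans res_characterization res_in_Q)

lemma Q_eq_iff: "n > 0 \<Longrightarrow> x \<in> Q n \<Longrightarrow> y \<in> Q n \<Longrightarrow> x = y \<longleftrightarrow> [x = y] (mod n)"
  by (metis res_eq_iff res_eq_self)

lemma res_add_left: "n > 0 \<Longrightarrow> res n (res n x + y) = res n (x + y)"
  by (simp add: res_eq_iff cong_add_rcancel cong_res)

text \<open>An inverse of the leading coefficient modulo \<open>n\<close> solves every equation, and
  coprimality lets it be cancelled for uniqueness. Conversely, solvability for a single well-chosen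
  \<open>b\<close> already produces such an inverse.\<close>

lemma affine_bij_iff_coprime:
  assumes "n > 0"
  shows "(\<forall>b\<in>Q n. \<exists>!x. x \<in> Q n \<and> res n (\<alpha> * x + e) = b) \<longleftrightarrow> coprime \<alpha> n"
proof
  assume "\<forall>b\<in>Q n. \<exists>!x. x \<in> Q n \<and> res n (\<alpha> * x + e) = b"
  \<comment> \<open>The right-hand side \<open>1 + e\<close> is chosen so that \<open>e\<close>
    cancels and \<open>x\<close> becomes the inverse.\<close>
  then obtain x where "res n (\<alpha> * x + e) = res n (1 + e)"
    using res_in_Q[OF assms] by blast
  then have "[\<alpha> * x = 1] (mod n)"
    using assms by (simp add: res_eq_iff cong_add_rcancel)
  then show "coprime \<alpha> n"
    using coprime_iff_invertible_int by blast
next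
  assume co: "coprime \<alpha> n"
  then obtain u where u: "[\<alpha> * u = 1] (mod n)"
    using cong_solve_coprime_int by blast
  show "\<forall>b\<in>Q n. \<exists>!x. x \<in> Q n \<and> res n (\<alpha> * x + e) = b"
  proof (intro ballI ex_ex1I)
    fix b assume b: "b \<in> Q n"
    have "[\<alpha> * res n (u * (b - e)) + e = \<alpha> * (u * (b - e)) + e] (mod n)"
      using assms by (intro cong_add cong_mult cong_res) auto
    also have "\<alpha> * (u * (b - e)) + e = \<alpha> * u * (b - e) + e"
      by simp
    also have "[\<dots> = 1 * (b - e) + e] (mod n)"
      using u by (intro cong_add cong_mult) auto
    finally have "res n (\<alpha> * res n (u * (b - e)) + e) = res n b"
      using assms by (simp add: res_eq_iff)
    then have "res n (\<alpha> * res n (u * (b - e)) + e) = b"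
      using assms b by (simp add: res_eq_self)
    then show "\<exists>x. x \<in> Q n \<and> res n (\<alpha> * x + e) = b"
      using assms res_in_Q by blast
  next
    fix b x y
    assume "x \<in> Q n \<and> res n (\<alpha> * x + e) = b" "y \<in> Q n \<and> res n (\<alpha> * y + e) = b"
    then have "[\<alpha> * x = \<alpha> * y] (mod n)" "x \<in> Q n" "y \<in> Q n"
      using assms by (auto simp: res_eq_iff cong_add_rcancel dest: sym)
    then show "x = y"
      using assms co by (simp add: Q_eq_iff cong_mult_lcancel)
  qed
qed

text \<open>Fixing one argument leaves an affine map in the other, whose constant term does not
  affect bijectivity.\<close>

lemma quasigroup_linear_iff:
  assumes "n > 0" and lin: "\<And>x y. x \<in> Q n \<Longrightarrow> y \<in> Q n \<Longrightarrow> f x y = res n (\<alpha> * x + \<beta> * y)"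
  shows "quasigroup n f \<longleftrightarrow> coprime \<alpha> n \<and> coprime \<beta> n"
proof -
  have "groupoid n f"
    using assms by (simp add: groupoid_def lin res_in_Q)
  moreover have "(\<exists>!x. x \<in> Q n \<and> f z x = b) \<longleftrightarrow> (\<exists>!x. x \<in> Q n \<and> res n (\<beta> * x + \<alpha> * z) = b)"
    "(\<exists>!x. x \<in> Q n \<and> f x z = b) \<longleftrightarrow> (\<exists>!x. x \<in> Q n \<and> res n (\<alpha> * x + \<beta> * z) = b)"
    if "z \<in> Q n" for z b
    using that by (auto simp: lin add.commute cong: conj_cong)
  \<comment> \<open>Some element must be available to fix; otherwise solvability would hold
    vacuously and say nothing about the coefficients.\<close>
  moreover have "Q n \<noteq> {}"
    using assms by (auto simp: Q_def)
  ultimately show ?thesis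
    unfolding quasigroup_def
    using affine_bij_iff_coprime[OF \<open>n > 0\<close>] by (auto simp: ball_conj_distrib)
qed

text \<open>Going from row 1 to row \<open>i\<close> takes \<open>i - 1\<close> translations, which
  move the column by \<open>(i - 1) * k\<close> in total.\<close>

lemma translatable_first_row:
  assumes "n > 0" and tr: "translatable n k f" and i: "i \<in> Q n"
  shows "f i (res n j) = f 1 (res n (j + k - k * i))"
proof -
  have "f 1 (res n j) = f (res n (1 + int t)) (res n (j + int t * k))" for t j
  proof (induction t)
    case 0
    have "1 \<in> Q n"
      using assms by (simp add: Q_def)
    then show ?case
      using assms by (simp add: res_eq_self)
  next
    case (Suc t)
    have "res n (res n (1 + int t) + 1) = res n (1 + int (Suc t))"
      "res n (res n (j + int t * k) + k) = res n (j + int (Suc t) * k)"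
      by (simp_all only: res_add_left[OF assms(1)]) (simp_all add: algebra_simps)
    moreover have "f (res n (1 + int t)) (res n (j + int t * k))
        = f (res n (res n (1 + int t) + 1)) (res n (res n (j + int t * k) + k))"
      using tr res_in_Q[OF assms(1)] unfolding translatable_def by blast
    ultimately show ?case
      using Suc by simp
  qed
  \<comment> \<open>The starting column is \<open>j - (i - 1) * k\<close>, so that the walk ends in
    column \<open>j\<close>.\<close>
  from this[of "j + k - k * i" "nat (i - 1)"] show ?thesis
    using i assms by (simp add: Q_def[of n] res_eq_self[OF \<open>n > 0\<close> i] algebra_simps)
qed

lemma idempotent_translatable_linear:
  assumes "n > 0" and "translatable n k f" and "idempotent n f"
  obtains u where "[(1 - k) * u = 1] (mod n)"
    and "\<And>i j. i \<in> Q n \<Longrightarrow> j \<in> Q n \<Longrightarrow> f i j = res n (u * j - u * k * i)"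
proof -
  \<comment> \<open>\<open>A\<close> is the first row extended periodically to all integers, which
    frees index arithmetic from \<open>res\<close>.\<close>
  define A where "A m = f 1 (res n m)" for m
  have A_cong: "A x = A y" if "[x = y] (mod n)" for x y
    using that assms by (simp add: A_def flip: res_eq_iff)
  have first: "f i j = A (j + k - k * i)" if "i \<in> Q n" "j \<in> Q n" for i j
    using translatable_first_row[OF assms(1,2) that(1), of j] that assms
    by (simp add: A_def res_eq_self)
  have idem: "A (k + (1 - k) * x) = res n x" for x
  proof -
    have "[k + (1 - k) * x = k + (1 - k) * res n x] (mod n)"
      using assms by (intro cong_add cong_mult cong_refl cong_sym[OF cong_res])
    then have "A (k + (1 - k) * x) = A (k + (1 - k) * res n x)"
      by (rule A_cong)
    also have "\<dots> = f (res n x) (res n x)"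
      using assms by (simp add: first res_in_Q algebra_simps)
    also have "\<dots> = res n x"
      using assms by (simp add: idempotent_def res_in_Q)
    finally show ?thesis .
  qed
  have "coprime (1 - k) n"
  proof -
    \<comment> \<open>With \<open>q = n / d\<close>, the product \<open>(1 - k) * q = p * n\<close>
      vanishes modulo \<open>n\<close>. Since \<open>idem\<close> recovers \<open>x\<close> modulo
      \<open>n\<close> from \<open>(1 - k) * x\<close>, \<open>n\<close> divides \<open>q\<close>,
      which forces \<open>d\<close> to be a unit.\<close>
    define d where "d = gcd (1 - k) n"
    obtain p q where pq: "1 - k = d * p" "n = d * q"
      unfolding d_def by (meson dvdE gcd_dvd1 gcd_dvd2)
    have "[k + (1 - k) * q = k + (1 - k) * 0] (mod n)"
      by (simp add: pq cong_iff_dvd_diff)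
    then have "res n q = res n 0"
      using A_cong idem by metis
    then have "d * q dvd 1 * q"
      using assms pq by (simp add: res_eq_iff cong_0_iff)
    then have "d dvd 1"
      using assms pq by auto
    then show ?thesis
      by (simp add: d_def coprime_iff_gcd_eq_1)
  qed
  then obtain u where u: "[(1 - k) * u = 1] (mod n)"
    using cong_solve_coprime_int by blast
  have "f i j = res n (u * j - u * k * i)" if "i \<in> Q n" "j \<in> Q n" for i j
  proof -
    \<comment> \<open>The index \<open>k + (j - k * i)\<close> is brought into the form required by
      \<open>idem\<close>, with \<open>x = u * (j - k * i)\<close>.\<close>
    have "[k + (1 - k) * u * (j - k * i) = k + 1 * (j - k * i)] (mod n)"
      using u by (intro cong_add cong_mult cong_refl)
    then have "A (k + 1 * (j - k * i)) = A (k + (1 - k) * (u * (j - k * i)))"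
      using A_cong cong_sym by (metis mult.assoc)
    also have "\<dots> = res n (u * j - u * k * i)"
      unfolding idem by (simp add: algebra_simps)
    finally show ?thesis
      using first[OF that] by (simp add: algebra_simps)
  qed
  with u that show ?thesis by blast
qed

theorem lemma4p1:
  fixes n k c :: int
    and f :: "int \<Rightarrow> int \<Rightarrow> int"
    and a :: "int \<Rightarrow> int"
  assumes "n > 0" and "k > 0"
    and "groupoid n f"
    and "idempotent n f"
    and "translatable n k f"
    and "translatable_sequence n k f a"
    and "c = f (res n 2) 1"
  shows "[k * c - c - 2 * k + 1 = 0] (mod n)
    \<and> (\<forall>x\<in>Q n. \<forall>y\<in>Q n. res n ((1 - k) * x) = res n ((1 - k) * y) \<longrightarrow> x = y)
    \<and> (\<forall>i\<in>Q n. a (res n (i + 1)) = res n (a i + (2 - c))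
                \<and> res n (a i + (2 - c)) = res n (1 + i * (2 - c)))
    \<and> (\<forall>x\<in>Q n. \<forall>y\<in>Q n. f x y = res n ((c - 1) * x + (2 - c) * y))
    \<and> (quasigroup n f \<longleftrightarrow> gcd k n = 1)
    \<and> (quasigroup n f \<longrightarrow> odd n)"
proof -
  note n = \<open>n > 0\<close>
  obtain u where u: "[(1 - k) * u = 1] (mod n)"
    and f_u: "\<And>i j. i \<in> Q n \<Longrightarrow> j \<in> Q n \<Longrightarrow> f i j = res n (u * j - u * k * i)"
    using idempotent_translatable_linear[OF n assms(5,4)] by blast
  have one: "1 \<in> Q n"
    using n by (simp add: Q_def)
  have "[u * 1 - u * k * res n 2 = u * 1 - u * k * 2] (mod n)"
    using n by (intro cong_diff cong_mult cong_refl cong_res)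
  then have c: "[c = u - 2 * u * k] (mod n)"
    unfolding assms(7) f_u[OF res_in_Q[OF n] one]
    using cong_trans[OF cong_res[OF n]] by (simp add: mult_ac)
  \<comment> \<open>Explicit multiples of \<open>n\<close> turn the congruences into integer
    equations, so the remaining identities are polynomial.\<close>
  obtain s where s: "u - u * k = 1 + n * s"
    using u by (auto simp: cong_iff_dvd_diff dvd_def algebra_simps)
  obtain t where t: "c = u - 2 * u * k + n * t"
    using c by (auto simp: cong_iff_dvd_diff dvd_def algebra_simps)
  have uk: "u * k = u - 1 - n * s"
    using s by linarith
  have c_eq: "c = 2 - u + n * (2 * s + t)"
    using t uk by algebra
  have i: "[k * c - c - 2 * k + 1 = 0] (mod n)"
  proof -
    have "k * c - c - 2 * k + 1 = n * (s - (1 - k) * (2 * s + t))"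
      using s c_eq by algebra
    then show ?thesis
      by (simp add: cong_0_iff)
  qed
  have co: "coprime (1 - k) n" "coprime u n"
    using u coprime_iff_invertible_int by (metis mult.commute)+
  have ii: "\<forall>x\<in>Q n. \<forall>y\<in>Q n. res n ((1 - k) * x) = res n ((1 - k) * y) \<longrightarrow> x = y"
    using n co by (simp add: res_eq_iff Q_eq_iff cong_mult_lcancel)
  have f_c: "f x y = res n ((c - 1) * x + (2 - c) * y)" if "x \<in> Q n" "y \<in> Q n" for x y
  proof -
    have "u * y - u * k * x - ((c - 1) * x + (2 - c) * y) = n * ((2 * s + t) * y - (s + t) * x)"
      unfolding uk c_eq by (simp add: algebra_simps)
    then show ?thesis
      using n that by (simp add: f_u res_eq_iff cong_iff_dvd_diff)
  qed
  have a: "a j = res n (c - 1 + (2 - c) * j)" if "j \<in> Q n" for j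
    using assms(6) that one f_c by (simp add: translatable_sequence_def)
  have iii: "\<forall>i\<in>Q n. a (res n (i + 1)) = res n (a i + (2 - c))
                \<and> res n (a i + (2 - c)) = res n (1 + i * (2 - c))"
  proof
    fix i assume "i \<in> Q n"
    \<comment> \<open>Since the affine formula depends only on the residue of its argument, the
      wrap-around at \<open>i = n\<close> needs no separate case.\<close>
    have "[c - 1 + (2 - c) * res n (i + 1) = c - 1 + (2 - c) * (i + 1)] (mod n)"
      using n by (intro cong_add cong_mult cong_refl cong_res)
    then have "a (res n (i + 1)) = res n (1 + i * (2 - c))"
      using n by (simp add: a res_in_Q res_eq_iff algebra_simps)
    moreover have "res n (a i + (2 - c)) = res n (1 + i * (2 - c))"
      unfolding a[OF \<open>i \<in> Q n\<close>] res_add_left[OF n] by (simp add: algebra_simps)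
    ultimately show "a (res n (i + 1)) = res n (a i + (2 - c))
                \<and> res n (a i + (2 - c)) = res n (1 + i * (2 - c))"
      by simp
  qed
  \<comment> \<open>As \<open>u\<close> is a unit modulo \<open>n\<close>, the coefficient
    \<open>- u * k\<close> is one exactly when \<open>k\<close> is.\<close>
  have "quasigroup n f \<longleftrightarrow> coprime (- u * k) n \<and> coprime u n"
    using n by (intro quasigroup_linear_iff) (simp_all add: f_u algebra_simps)
  then have v: "quasigroup n f \<longleftrightarrow> gcd k n = 1"
    using co by (simp add: coprime_iff_gcd_eq_1[symmetric])
  have vi: "odd n" if "quasigroup n f"
  proof
    assume "even n"
    have "coprime k n"
      using that v by (simp add: coprime_iff_gcd_eq_1)
    then have "odd k" "odd (1 - k)"
      using \<open>even n\<close> co(1) by (auto dest: coprime_common_divisor[of _ _ 2])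
    then show False
      by simp
  qed
  show ?thesis
    using i ii iii f_c v vi by blast
qed

end
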